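(* Let $D$ be the derivation on the ring of Laurent polynomials in the commuting variables $u,v,z$ determined by $D(z)=vz^2$, $D(v)=uv^2z$, $D(u)=u^2vz$ (extended by linearity and the Leibniz rule). Then for every $n\ge 1$, $$D^{n-1}(z)=v^{n-1}z^{n}T_{n-1}(u),$$ where $T_0(u)=1$.
   Context: For a rooted tree, an edge is written $(i,j)$ where $j$ is a child of $i$; every vertex is a descendant of itself; the edge $(i,j)$ is improper if some descendant of $j$ is smaller than $i$, and proper otherwise. For $m\ge1$, let $T(m,k)$ be the number of rooted trees on vertex set $\{1,\dots,m+1\}$ with root $1$ having exactly $k$ improper edges, and $T_m(u)=\sum_{k=0}^{m-1}T(m,k)u^k$. *)

theory Defs
  imports Complex_Main "HOL-Library.Poly_Mapping" "HOL-Library.Product_Plus"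
begin

text \<open>
  Laurent polynomials in three commuting variables over a commutative ring, as the group
  algebra of the free abelian group of exponent vectors: the key \<open>(a, b, c)\<close> stands for the
  monomial \<open>u\<^sup>a v\<^sup>b z\<^sup>c\<close>.
\<close>

type_synonym 'a laurent3 = "(int \<times> int \<times> int) \<Rightarrow>\<^sub>0 'a"

definition U :: "'a::comm_ring_1 laurent3"
  where "U = Poly_Mapping.single (1, 0, 0) 1"

definition V :: "'a::comm_ring_1 laurent3"
  where "V = Poly_Mapping.single (0, 1, 0) 1"

definition Z :: "'a::comm_ring_1 laurent3"
  where "Z = Poly_Mapping.single (0, 0, 1) 1"

definition laurent_const :: "'a::comm_ring_1 \<Rightarrow> 'a laurent3"
  where "laurent_const r = Poly_Mapping.single 0 r"

definition derivation :: "('a::comm_ring_1 laurent3 \<Rightarrow> 'a laurent3) \<Rightarrow> bool" where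
  "derivation D \<longleftrightarrow>
     (\<forall>f g. D (f + g) = D f + D g) \<and>
     (\<forall>r f. D (laurent_const r * f) = laurent_const r * D f) \<and>
     (\<forall>f g. D (f * g) = D f * g + f * D g)"

text \<open>
  A rooted tree is given by its set of edges \<open>(i, j)\<close> with \<open>j\<close> a child of \<open>i\<close>, so that all
  edges point away from the root.
\<close>

definition rooted_tree :: "'v set \<Rightarrow> 'v \<Rightarrow> ('v \<times> 'v) set \<Rightarrow> bool" where
  "rooted_tree vs r E \<longleftrightarrow>
     r \<in> vs \<and> E \<subseteq> vs \<times> vs \<and>
     (\<forall>i. (i, r) \<notin> E) \<and>
     (\<forall>j\<in>vs - {r}. \<exists>!i. (i, j) \<in> E) \<and>
     (\<forall>j\<in>vs. (r, j) \<in> E\<^sup>*)"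

definition descendants :: "('v \<times> 'v) set \<Rightarrow> 'v \<Rightarrow> 'v set"
  where "descendants E j = {d. (j, d) \<in> E\<^sup>*}"

definition improper_edges :: "('v::linorder \<times> 'v) set \<Rightarrow> ('v \<times> 'v) set"
  where "improper_edges E = {(i, j). (i, j) \<in> E \<and> (\<exists>d\<in>descendants E j. d < i)}"

definition T :: "nat \<Rightarrow> nat \<Rightarrow> nat" where
  "T m k = card {E. rooted_tree {1..m+1} 1 E \<and> card (improper_edges E) = k}"

definition T_poly :: "nat \<Rightarrow> 'r::comm_semiring_1 \<Rightarrow> 'r" where
  "T_poly m x = (if m = 0 then 1 else (\<Sum>k=0..m-1. of_nat (T m k) * x ^ k))"

text \<open>
  The derivation of the grammar exists and is unique: it sends \<open>u\<^sup>a v\<^sup>b z\<^sup>c\<close> to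
  \<open>((a + b) u v z + c v z) u\<^sup>a v\<^sup>b z\<^sup>c\<close>.
\<close>

lemma laurent3_induct [case_names add single]:
  fixes f :: "'a::comm_ring_1 laurent3"
  assumes "\<And>f g. P f \<Longrightarrow> P g \<Longrightarrow> P (f + g)" and "\<And>k r. P (Poly_Mapping.single k r)"
  shows "P f"
proof (induction f rule: update_induct)
  case const
  then show ?case using assms(2)[of 0 0] by simp
next
  case (update f a b)
  have "Poly_Mapping.update a b f = f + Poly_Mapping.single a b"
    using update by (intro poly_mapping_eqI)
      (auto simp: lookup_update lookup_add lookup_single when_def in_keys_iff)
  then show ?case using assms update by metis
qed

lift_definition euler_op :: "(int \<times> int \<times> int \<Rightarrow> int) \<Rightarrow> 'a::comm_ring_1 laurent3 \<Rightarrow> 'a laurent3"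
  is "\<lambda>w f k. of_int (w k) * f k"
  by (erule finite_subset[rotated]) auto

lemma euler_op_single [simp]:
  "euler_op w (Poly_Mapping.single k r) = Poly_Mapping.single k (of_int (w k) * r)"
  by (intro poly_mapping_eqI) (auto simp: euler_op.rep_eq lookup_single when_def)

lemma euler_op_add: "euler_op w (f + g) = euler_op w f + euler_op w g"
  by (intro poly_mapping_eqI) (auto simp: euler_op.rep_eq lookup_add algebra_simps)

lemma euler_op_mult:
  assumes w: "\<And>k l. w (k + l) = w k + w l"
  shows "euler_op w (f * g) = euler_op w f * g + f * euler_op w g"
proof (induction f rule: laurent3_induct)
  case (add f f')
  then show ?case by (simp add: euler_op_add algebra_simps)
next
  case (single k r)
  show ?case
  proof (induction g rule: laurent3_induct)
    case (add g g')
    then show ?case by (simp add: euler_op_add algebra_simps)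
  next
    case (single l s)
    show ?case by (simp add: mult_single w single_add[symmetric] algebra_simps)
  qed
qed

lemma derivation_vanishes:
  fixes D :: "'a::comm_ring_1 laurent3 \<Rightarrow> 'a laurent3"
  assumes D: "derivation D" and "D U = 0" "D V = 0" "D Z = 0"
  shows "D f = 0"
proof -
  define X :: "int \<times> int \<times> int \<Rightarrow> 'a laurent3" where "X k = Poly_Mapping.single k 1" for k
  have X_add: "X (k + l) = X k * X l" for k l by (simp add: X_def mult_single)
  have X0: "X 0 = 1" by (simp add: X_def)
  have leib: "D (f * g) = D f * g + f * D g" for f g using D by (simp add: derivation_def)
  have D0: "D (X 0) = 0" using leib[of 1 1] by (simp add: X0)
  have add: "D (X (k + l)) = 0" if "D (X k) = 0" "D (X l) = 0" for k l
    using that by (simp add: X_add leib)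
  have neg: "D (X (- k)) = 0" if "D (X k) = 0" for k
  proof -
    have inv: "X k * X (- k) = 1" using X_add[of k "- k"] X0 by simp
    have "0 = D (X k * X (- k))" using D0 X0 inv by simp
    also have "\<dots> = X k * D (X (- k))" using that by (simp add: leib)
    finally have "X (- k) * (X k * D (X (- k))) = 0" by simp
    then show ?thesis using inv by (simp add: mult.assoc[symmetric] mult.commute)
  qed
  have line: "D (X (h a)) = 0"
    if h: "\<And>a b. h (a + b) = h a + h b" "\<And>a. h (- a) = - h a" "h 0 = 0" and 1: "D (X (h 1)) = 0"
    for h and a :: int
  proof -
    have nat: "D (X (h (int n))) = 0" for n
    proof (induction n)
      case (Suc n)
      then show ?case using add[of "h 1" "h (int n)"] 1 h(1)[of 1 "int n"] by simp
    qed (use D0 h in simp)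
    show ?thesis
      using nat neg h(2) by (cases a rule: int_cases2) metis+
  qed
  have gen: "D (X (1, 0, 0)) = 0" "D (X (0, 1, 0)) = 0" "D (X (0, 0, 1)) = 0"
    using assms by (simp_all add: X_def U_def V_def Z_def)
  have "D (X (a, 0, 0)) = 0" "D (X (0, b, 0)) = 0" "D (X (0, 0, c)) = 0" for a b c
    using line[of "\<lambda>a. (a, 0, 0)" a] line[of "\<lambda>a. (0, a, 0)" b] line[of "\<lambda>a. (0, 0, a)" c] gen
    by (simp_all add: zero_prod_def)
  from add[OF this(1) add[OF this(2,3)]] have mono: "D (X (a, b, c)) = 0" for a b c by simp
  show ?thesis
  proof (induction f rule: laurent3_induct)
    case (add f g)
    then show ?case using D by (simp add: derivation_def)
  next
    case (single k r)
    have "Poly_Mapping.single k r = laurent_const r * X k"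
      by (simp add: laurent_const_def X_def mult_single)
    then have "D (Poly_Mapping.single k r) = laurent_const r * D (X k)"
      using D unfolding derivation_def by metis
    then show ?case using mono by (cases k) simp
  qed
qed

lemma ex1_grammar_derivation:
  "\<exists>!D :: 'a::comm_ring_1 laurent3 \<Rightarrow> 'a laurent3.
     derivation D \<and> D Z = V * Z^2 \<and> D V = U * V^2 * Z \<and> D U = U^2 * V * Z"
proof (rule ex_ex1I)
  let ?e = "euler_op (\<lambda>(a, b, c). a + b) :: 'a laurent3 \<Rightarrow> _"
  let ?e' = "euler_op (\<lambda>(a, b, c). c) :: 'a laurent3 \<Rightarrow> _"
  let ?D = "\<lambda>f. ?e f * (U * V * Z) + ?e' f * (V * Z)"
  have leib: "?e (f * g) = ?e f * g + f * ?e g" "?e' (f * g) = ?e' f * g + f * ?e' g" for f g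
    by (rule euler_op_mult; auto)+
  have const: "?e (laurent_const r) = 0" "?e' (laurent_const r) = 0" for r
    by (simp_all add: laurent_const_def zero_prod_def)
  have "derivation ?D"
    unfolding derivation_def
    by (simp add: leib const euler_op_add algebra_simps)
  moreover have "?D Z = V * Z^2" "?D V = U * V^2 * Z" "?D U = U^2 * V * Z"
    by (simp_all add: U_def V_def Z_def mult_single power2_eq_square)
  ultimately show "\<exists>D :: 'a laurent3 \<Rightarrow> 'a laurent3.
     derivation D \<and> D Z = V * Z^2 \<and> D V = U * V^2 * Z \<and> D U = U^2 * V * Z"
    by blast
next
  fix D D' :: "'a laurent3 \<Rightarrow> 'a laurent3"
  assume D: "derivation D \<and> D Z = V * Z^2 \<and> D V = U * V^2 * Z \<and> D U = U^2 * V * Z"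
    and D': "derivation D' \<and> D' Z = V * Z^2 \<and> D' V = U * V^2 * Z \<and> D' U = U^2 * V * Z"
  have "derivation (\<lambda>f. D f - D' f)"
    unfolding derivation_def
  proof (intro conjI allI)
    fix f g r
    show "D (f + g) - D' (f + g) = D f - D' f + (D g - D' g)"
      using D D' by (simp add: derivation_def)
    have "D (laurent_const r * f) = laurent_const r * D f"
      "D' (laurent_const r * f) = laurent_const r * D' f"
      using D D' unfolding derivation_def by metis+
    then show "D (laurent_const r * f) - D' (laurent_const r * f) = laurent_const r * (D f - D' f)"
      by (simp add: right_diff_distrib)
    have "D (f * g) = D f * g + f * D g" "D' (f * g) = D' f * g + f * D' g"
      using D D' unfolding derivation_def by metis+
    then show "D (f * g) - D' (f * g) = (D f - D' f) * g + f * (D g - D' g)"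
      by (simp add: algebra_simps)
  qed
  then have "D f - D' f = 0" for f
    by (rule derivation_vanishes) (use D D' in auto)
  then show "D = D'" by auto
qed

end

theory Submission
  imports Defs
begin

text \<open>
  Since \<open>D\<close> sends \<open>v\<^sup>m z\<^sup>m\<^sup>+\<^sup>1 u\<^sup>k\<close> to
  \<open>v\<^sup>m\<^sup>+\<^sup>1 z\<^sup>m\<^sup>+\<^sup>2 ((m + 1) u\<^sup>k + (m + k) u\<^sup>k\<^sup>+\<^sup>1)\<close>, the theorem amounts to Shor's
  recurrence \<open>T(m+1,k+1) = (m+1) T(m,k+1) + (m+k) T(m,k)\<close>. Adjoin a new largest vertex \<open>n\<close>
  to a tree with \<open>m+1\<close> vertices. As a leaf it can hang below any vertex and leaves the number of
  improper edges unchanged. Otherwise all edges from \<open>n\<close> to its children are improper; let \<open>x\<close>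
  be the child whose subtree has the largest minimum and contract the edge \<open>(n,x)\<close>. This loses
  exactly one improper edge, for an edge \<open>(n,c)\<close> with \<open>c \<noteq> x\<close> becomes \<open>(x,c)\<close>, still improper by the
  choice of \<open>x\<close>. The children to be moved back from \<open>x\<close> to \<open>n\<close> are those whose subtree minimum
  is below the minimum \<open>t\<close> of the old subtree of \<open>x\<close>. The possible \<open>t\<close> are \<open>x\<close> itself and the subtree
  minima at the improper edges leaving \<open>x\<close>, so there are \<open>m + k\<close> pairs \<open>(x,t)\<close> for a tree with
  \<open>k\<close> improper edges.
\<close>

section \<open>Paths in rooted trees\<close>

lemma tree_parent_unique:
  assumes "rooted_tree vs r E" "(a, j) \<in> E" "(b, j) \<in> E"
  shows "a = b"
proof -
  have "j \<in> vs - {r}" using assms by (auto simp: rooted_tree_def)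
  then show ?thesis using assms unfolding rooted_tree_def by blast
qed

lemma tree_subset: "rooted_tree vs r E \<Longrightarrow> E \<subseteq> vs \<times> vs"
  by (simp add: rooted_tree_def)

text \<open>Induction along the path from the root: a cycle through a vertex enters it by its only
  incoming edge, so it also passes through the parent, and finally through the root, which has no
  incoming edge.\<close>

lemma tree_acyclic:
  assumes t: "rooted_tree vs r E"
  shows "(a, a) \<notin> E\<^sup>+"
proof
  assume a: "(a, a) \<in> E\<^sup>+"
  then have "a \<in> vs"
    using t by (metis SigmaE2 rooted_tree_def subsetD tranclE)
  then have "(r, a) \<in> E\<^sup>*" using t by (auto simp: rooted_tree_def)
  then have "(a, a) \<notin> E\<^sup>+"
  proof (induction rule: rtrancl_induct)
    case base
    show ?case using t by (metis rooted_tree_def tranclE)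
  next
    case (step y z)
    show ?case
    proof
      assume "(z, z) \<in> E\<^sup>+"
      then obtain y' where "(z, y') \<in> E\<^sup>*" "(y', z) \<in> E" by (metis tranclD2)
      moreover from this have "y' = y" using tree_parent_unique[OF t] step by blast
      ultimately show False using step by (metis rtrancl_into_trancl2)
    qed
  qed
  with a show False by simp
qed

text \<open>Parents are unique, so the converse of \<open>E\<close> is single-valued and two
  ancestors of \<open>d\<close> are comparable. A path between distinct siblings would pass through
  their parent \<open>a\<close> and close a cycle.\<close>

lemma tree_siblings_disjoint:
  assumes t: "rooted_tree vs r E" and e: "(a, b) \<in> E" "(a, c) \<in> E"
    and d: "d \<in> descendants E b" "d \<in> descendants E c"
  shows "b = c"
proof -
  have sv: "single_valued (E\<inverse>)"
    using tree_parent_unique[OF t] by (auto simp: single_valued_def)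
  have *: "b = c" if bc: "(b, c) \<in> E\<^sup>*" and "(a, b) \<in> E" "(a, c) \<in> E" for b c
  proof (rule ccontr)
    assume "b \<noteq> c"
    then obtain y where "(b, y) \<in> E\<^sup>*" "(y, c) \<in> E"
      using bc by (auto elim: rtranclE)
    moreover from this have "y = a" using tree_parent_unique[OF t] that by blast
    ultimately have "(a, a) \<in> E\<^sup>+" using that by (metis rtrancl_into_trancl2)
    then show False using tree_acyclic[OF t] by simp
  qed
  have "(d, b) \<in> (E\<inverse>)\<^sup>*" "(d, c) \<in> (E\<inverse>)\<^sup>*"
    using d by (simp_all add: descendants_def rtrancl_converse)
  from single_valued_confluent[OF sv this] show ?thesis
    using * e by (metis rtrancl_converseD)
qed

lemma image_restrict: "A \<subseteq> f ` B \<Longrightarrow> A = f ` {b \<in> B. f b \<in> A}"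
  by blast

lemma self_in_descendants [simp]: "j \<in> descendants E j"
  by (simp add: descendants_def)

lemma finite_descendants: "finite E \<Longrightarrow> finite (descendants E j)"
proof (rule finite_subset)
  show "descendants E j \<subseteq> insert j (Range E)"
    by (auto simp: descendants_def elim: rtranclE)
qed (simp add: finite_Range)

section \<open>Subtree minima\<close>

definition min_desc :: "('v::linorder \<times> 'v) set \<Rightarrow> 'v \<Rightarrow> 'v"
  where "min_desc E j = Min (descendants E j)"

lemma min_desc_in: "finite E \<Longrightarrow> min_desc E j \<in> descendants E j"
  unfolding min_desc_def by (rule Min_in) (auto simp: finite_descendants intro: self_in_descendants)

lemma min_desc_le: "finite E \<Longrightarrow> d \<in> descendants E j \<Longrightarrow> min_desc E j \<le> d"
  unfolding min_desc_def by (simp add: finite_descendants)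

lemma min_desc_child:
  assumes "finite E" "(i, j) \<in> E"
  shows "min_desc E i \<le> min_desc E j"
proof (rule min_desc_le[OF assms(1)])
  show "min_desc E j \<in> descendants E i"
    using min_desc_in[OF assms(1), of j] assms(2)
    by (auto simp: descendants_def intro: converse_rtrancl_into_rtrancl)
qed

text \<open>The path from \<open>j\<close> to the minimum is either empty or starts with an edge to
  a child.\<close>

lemma min_desc_cases:
  assumes "finite E"
  obtains "min_desc E j = j" | c where "(j, c) \<in> E" "min_desc E j = min_desc E c"
proof -
  have "(j, min_desc E j) \<in> E\<^sup>*" using min_desc_in[OF assms, of j] by (simp add: descendants_def)
  then show thesis
  proof (cases rule: converse_rtranclE)
    case (step c)
    then have "min_desc E c \<le> min_desc E j" 
      using min_desc_le[OF assms] by (simp add: descendants_def)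
    with min_desc_child[OF assms step(1)] have "min_desc E j = min_desc E c" by simp
    then show thesis using that(2) step(1) by blast
  qed (use that in auto)
qed

lemma improper_edges_subset: "improper_edges E \<subseteq> E"
  by (auto simp: improper_edges_def)

lemma improper_edges_eq:
  "finite E \<Longrightarrow> improper_edges E = {(i, j). (i, j) \<in> E \<and> min_desc E j < i}"
  unfolding improper_edges_def
  by (auto intro: le_less_trans[OF min_desc_le] bexI[OF _ min_desc_in])

text \<open>A common minimum would lie in both subtrees. This separates the children of a vertex by
  their subtree minima, which makes the choice of \<open>x\<close> unambiguous and the count of
  pairs \<open>(x, t)\<close> exact.\<close>

lemma min_desc_siblings:
  assumes "rooted_tree vs r E" "finite E" "(a, b) \<in> E" "(a, c) \<in> E" "min_desc E b = min_desc E c"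
  shows "b = c"
  using tree_siblings_disjoint[OF assms(1,3,4)] assms(5) min_desc_in[OF assms(2)] by metis

section \<open>Contraction of an edge and its inverse\<close>

text \<open>The merged vertex keeps the name \<open>x\<close>, so the old vertex set
  \<open>vs\<close> remains. The edge \<open>(n, x)\<close> is removed first because renaming would
  turn it into a loop.\<close>

definition contract :: "'v \<Rightarrow> 'v \<Rightarrow> ('v \<times> 'v) set \<Rightarrow> ('v \<times> 'v) set"
  where "contract n x E = map_prod (id(n := x)) (id(n := x)) ` (E - {(n, x)})"

text \<open>The start \<open>a = x\<close> is excluded: the merged vertex inherits the descendants
  of \<open>n\<close>, which \<open>x\<close> does not reach in \<open>E\<close>.\<close>

lemma contract_rtrancl_iff:
  assumes nx: "(n, x) \<in> E" and x: "\<And>a. (a, x) \<in> E \<Longrightarrow> a = n" and a: "a \<noteq> x"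
  shows "((id(n := x)) a, (id(n := x)) b) \<in> (contract n x E)\<^sup>* \<longleftrightarrow> (a, b) \<in> E\<^sup>*"
proof -
  let ?f = "id(n := x)" and ?E = "contract n x E"
  \<comment> \<open>The claim is for every preimage \<open>b\<close> of the endpoint, since the
    endpoint \<open>x\<close> has the two preimages \<open>n\<close> and \<open>x\<close>.\<close>
  have up: "(a, b) \<in> E\<^sup>*" if "(?f a, b') \<in> ?E\<^sup>*" "?f b = b'" for b b'
    using that
  proof (induction arbitrary: b rule: rtrancl_induct)
    case base
    then have "b = a \<or> (a = n \<and> b = x)" using a by (simp split: if_splits)
    then show ?case using nx by blast
  next
    case (step c' d')
    obtain e where e: "(c', d') = map_prod ?f ?f e" "e \<in> E - {(n, x)}"
      using step.hyps(2) unfolding contract_def by (rule imageE)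
    obtain c d where "e = (c, d)" by (cases e)
    with e have cd: "(c, d) \<in> E" "(c, d) \<noteq> (n, x)" "?f c = c'" "?f d = d'" by simp_all
    have "(a, d) \<in> E\<^sup>*" using step.IH[OF cd(3)] cd(1) by simp
    \<comment> \<open>The only edge into \<open>x\<close> has been removed. Thus the last edge ends
      in \<open>b\<close> itself, or in \<open>n\<close> with \<open>b = x\<close>, one step further
      along \<open>(n, x)\<close>.\<close>
    moreover have "d \<noteq> x" using x[of c] cd by auto
    then have "b = d \<or> (d = n \<and> b = x)" using cd(4) step.prems by (auto split: if_splits)
    ultimately show ?case using nx by auto
  qed
  have down: "(?f a, ?f b) \<in> ?E\<^sup>*" if "(a, b) \<in> E\<^sup>*"
    using that
  proof (induction rule: rtrancl_induct)
    case (step c d)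
    show ?case
    proof (cases "(c, d) = (n, x)")
      case False
      then have "(?f c, ?f d) \<in> ?E"
        using step(2) unfolding contract_def by (intro image_eqI[of _ _ "(c, d)"]) auto
      then show ?thesis using step.IH by (rule rtrancl_into_rtrancl[rotated])
    qed (use step in auto)
  qed simp
  show ?thesis using up down by blast
qed

text \<open>
  Inverse of the contraction: \<open>t\<close> is the minimum that the subtree of \<open>x\<close> is to have afterwards.
\<close>

definition expand :: "'v::linorder \<Rightarrow> 'v \<Rightarrow> 'v \<Rightarrow> ('v \<times> 'v) set \<Rightarrow> ('v \<times> 'v) set"
  where "expand n x t E = insert (n, x)
    ((\<lambda>(i, j). if j = x then (i, n) else if i = x \<and> min_desc E j < t then (n, j) else (i, j)) ` E)"

definition trees :: "'v::linorder set \<Rightarrow> 'v \<Rightarrow> nat \<Rightarrow> ('v \<times> 'v) set set"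
  where "trees vs r k = {E. rooted_tree vs r E \<and> card (improper_edges E) = k}"

text \<open>The diagonal covers the case that \<open>x\<close> is the minimum of its own new
  subtree; a smaller minimum is supplied by an improper edge leaving \<open>x\<close>. The root is
  left out because \<open>x\<close> is to become a child of \<open>n\<close>.\<close>

definition expansion_data :: "'v::linorder set \<Rightarrow> 'v \<Rightarrow> ('v \<times> 'v) set \<Rightarrow> ('v \<times> 'v) set"
  where "expansion_data vs r E =
    {(x, x) |x. x \<in> vs - {r}} \<union> (\<lambda>(x, c). (x, min_desc E c)) ` improper_edges E"

text \<open>No edge leaving the least vertex \<open>r\<close> is improper, whereas every edge from
  the greatest vertex \<open>n\<close> to a child is.\<close>

locale new_maximum =
  fixes vs :: "'v::linorder set" and r n :: 'v
  assumes fin: "finite vs" and r: "r \<in> vs" "\<And>v. v \<in> vs \<Longrightarrow> r \<le> v"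
    and n: "\<And>v. v \<in> vs \<Longrightarrow> v < n"
begin

lemma n_notin: "n \<notin> vs" using n by blast

lemma finite_tree:
  assumes "rooted_tree vs r E" shows "finite E"
  using assms finite_subset[of E "vs \<times> vs"] fin unfolding rooted_tree_def by blast

lemma finite_tree':
  assumes "rooted_tree (insert n vs) r E" shows "finite E"
  using assms finite_subset[of E "insert n vs \<times> insert n vs"] fin
  unfolding rooted_tree_def by blast

lemma finite_trees: "finite (trees vs r k)"
proof (rule finite_subset)
  show "trees vs r k \<subseteq> Pow (vs \<times> vs)" unfolding trees_def rooted_tree_def by blast
qed (use fin in simp)

lemma finite_trees': "finite (trees (insert n vs) r k)"
proof (rule finite_subset)
  show "trees (insert n vs) r k \<subseteq> Pow (insert n vs \<times> insert n vs)"
    unfolding trees_def rooted_tree_def by blast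
qed (use fin in simp)

lemma descendants_subset:
  assumes "rooted_tree ws r E" "j \<in> ws" shows "descendants E j \<subseteq> ws"
proof
  fix d assume "d \<in> descendants E j"
  then have "(j, d) \<in> E\<^sup>*" by (simp add: descendants_def)
  then show "d \<in> ws" by (rule rtranclE) (use assms in \<open>auto simp: rooted_tree_def\<close>)
qed

lemma rooted_tree_contract:
  assumes t: "rooted_tree (insert n vs) r E" and nx: "(n, x) \<in> E"
  shows "rooted_tree vs r (contract n x E)"
proof -
  let ?f = "id(n := x)" and ?E = "contract n x E"
  have x: "a = n" if "(a, x) \<in> E" for a using tree_parent_unique[OF t that nx] .
  have nr: "n \<noteq> r" using r n_notin by blast
  have "x \<noteq> n" using tree_acyclic[OF t] nx by blast
  then have xv: "x \<in> vs" using t nx by (auto simp: rooted_tree_def)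
  have xr: "x \<noteq> r" using t nx by (auto simp: rooted_tree_def)
  have sub: "E \<subseteq> insert n vs \<times> insert n vs" using t by (simp add: rooted_tree_def)
  \<comment> \<open>Since \<open>n\<close> is the only parent of \<open>x\<close>, removing the edge
    \<open>(n, x)\<close> amounts to the condition \<open>b \<noteq> x\<close>.\<close>
  have E: "(i, j) \<in> ?E \<longleftrightarrow> (\<exists>a b. (a, b) \<in> E \<and> b \<noteq> x \<and> i = ?f a \<and> j = ?f b)" for i j
  proof
    assume "(i, j) \<in> ?E"
    then obtain e where e: "(i, j) = map_prod ?f ?f e" "e \<in> E - {(n, x)}"
      unfolding contract_def by (rule imageE)
    obtain a b where ab: "e = (a, b)" by (cases e)
    have "b \<noteq> x" using x[of a] e ab by auto
    then show "\<exists>a b. (a, b) \<in> E \<and> b \<noteq> x \<and> i = ?f a \<and> j = ?f b"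
      using e ab by (intro exI[of _ a] exI[of _ b]) simp
  next
    assume "\<exists>a b. (a, b) \<in> E \<and> b \<noteq> x \<and> i = ?f a \<and> j = ?f b"
    then obtain a b where "(a, b) \<in> E" "b \<noteq> x" "i = ?f a" "j = ?f b" by blast
    then show "(i, j) \<in> ?E"
      unfolding contract_def by (intro image_eqI[of _ _ "(a, b)"]) auto
  qed
  show ?thesis unfolding rooted_tree_def
  proof (intro conjI ballI allI)
    show "?E \<subseteq> vs \<times> vs"
    proof (rule subrelI)
      fix i j assume "(i, j) \<in> ?E"
      then obtain a b where ab: "(a, b) \<in> E" "i = ?f a" "j = ?f b" unfolding E by blast
      then have "a \<in> insert n vs" "b \<in> insert n vs" using sub by blast+
      then show "(i, j) \<in> vs \<times> vs" using ab xv by auto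
    qed
    show "(i, r) \<notin> ?E" for i
    proof
      assume "(i, r) \<in> ?E"
      then obtain a b where ab: "(a, b) \<in> E" "r = ?f b" unfolding E by blast
      then have "b = r" using xr by (auto split: if_splits)
      then show False using ab t by (auto simp: rooted_tree_def)
    qed
    show "\<exists>!i. (i, j) \<in> ?E" if j: "j \<in> vs - {r}" for j
    proof -
      \<comment> \<open>The vertex of the old tree whose parent edge becomes the parent edge of
        \<open>j\<close>: the merged vertex \<open>x\<close> takes over the parent of
        \<open>n\<close>.\<close>
      define j' where "j' = (if j = x then n else j)"
      have "j' \<in> insert n vs - {r}" using j nr by (auto simp: j'_def)
      then obtain i where i: "(i, j') \<in> E" using t unfolding rooted_tree_def by blast
      have b: "b = j'" if "b \<noteq> x" "j = ?f b" for b
        using that j n_notin by (auto simp: j'_def split: if_splits)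
      show ?thesis
      proof (rule ex1I)
        show "(?f i, j) \<in> ?E"
          unfolding E using i \<open>x \<noteq> n\<close> n_notin j by (intro exI[of _ i] exI[of _ j']) (auto simp: j'_def)
        fix k assume "(k, j) \<in> ?E"
        then obtain a c where ac: "(a, c) \<in> E" "c \<noteq> x" "k = ?f a" "j = ?f c" by (auto simp: E)
        then have "a = i" using b i tree_parent_unique[OF t] by metis
        then show "k = ?f i" using ac by simp
      qed
    qed
    show "(r, j) \<in> ?E\<^sup>*" if "j \<in> vs" for j
    proof -
      have "(r, j) \<in> E\<^sup>*" using t that by (auto simp: rooted_tree_def)
      from contract_rtrancl_iff[OF nx x, THEN iffD2, OF _ _ this]
      show ?thesis using xr nr that n_notin by (auto split: if_splits)
    qed
  qed (use r in simp)
qed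

text \<open>The set of descendants of \<open>a\<close> can lose only \<open>n\<close>, and
  \<open>n\<close> is never the minimum because its child \<open>x\<close> is smaller.\<close>

lemma min_desc_contract:
  assumes t: "rooted_tree (insert n vs) r E" and nx: "(n, x) \<in> E"
    and a: "a \<in> insert n vs" "a \<noteq> x"
  shows "min_desc (contract n x E) ((id(n := x)) a) = min_desc E a"
proof -
  let ?f = "id(n := x)" and ?E = "contract n x E"
  have x: "b = n" if "(b, x) \<in> E" for b using tree_parent_unique[OF t that nx] .
  note iff = contract_rtrancl_iff[OF nx x a(2)]
  have t': "rooted_tree vs r ?E" by (rule rooted_tree_contract[OF t nx])
  have fE: "finite E" "finite ?E" using finite_tree finite_tree' t t' by auto
  have "x \<noteq> n" using tree_acyclic[OF t] nx by blast
  then have xv: "x \<in> vs" using t nx by (auto simp: rooted_tree_def)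
  have fa: "?f a \<in> vs" using a xv by auto
  show ?thesis
  proof (rule antisym)
    have "min_desc E a \<noteq> n"
    proof
      assume "min_desc E a = n"
      moreover have "x \<in> descendants E a" if "n \<in> descendants E a"
        using that nx by (auto simp: descendants_def)
      ultimately show False using min_desc_in[OF fE(1), of a] min_desc_le[OF fE(1), of x a] n[OF xv]
        by auto
    qed
    then have "min_desc E a \<in> descendants ?E (?f a)"
      using iff[of "min_desc E a"] min_desc_in[OF fE(1), of a] by (auto simp: descendants_def)
    then show "min_desc ?E (?f a) \<le> min_desc E a" by (rule min_desc_le[OF fE(2)])
    have "min_desc ?E (?f a) \<in> descendants ?E (?f a)" by (rule min_desc_in[OF fE(2)])
    moreover from this have "min_desc ?E (?f a) \<noteq> n"
      using descendants_subset[OF t' fa] n_notin by auto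
    ultimately have "min_desc ?E (?f a) \<in> descendants E a"
      using iff[of "min_desc ?E (?f a)"] by (auto simp: descendants_def)
    then show "min_desc E a \<le> min_desc ?E (?f a)" by (rule min_desc_le[OF fE(1)])
  qed
qed

section \<open>Contracting the edge from the new vertex to its heavy child\<close>

definition heavy_child :: "('v \<times> 'v) set \<Rightarrow> 'v \<Rightarrow> bool"
  where "heavy_child E x \<longleftrightarrow>
    (n, x) \<in> E \<and> (\<forall>c. (n, c) \<in> E \<longrightarrow> c \<noteq> x \<longrightarrow> min_desc E c < min_desc E x)"

lemma heavy_child_unique: "heavy_child E x \<Longrightarrow> heavy_child E y \<Longrightarrow> x = y"
  unfolding heavy_child_def by (metis less_asym)

text \<open>The maximum over the finitely many children is strict because siblings have different
  subtree minima.\<close>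

lemma heavy_child_exists:
  assumes t: "rooted_tree (insert n vs) r E" and "(n, c) \<in> E"
  obtains x where "heavy_child E x"
proof -
  have fE: "finite E" using t by (rule finite_tree')
  let ?C = "E `` {n}"
  have C: "finite ?C" "?C \<noteq> {}" using fE assms by auto
  obtain x where x: "x \<in> ?C" "min_desc E x = Max (min_desc E ` ?C)"
    using Max_in[of "min_desc E ` ?C"] C by fastforce
  have "min_desc E c < min_desc E x" if "(n, c) \<in> E" "c \<noteq> x" for c
  proof -
    have "min_desc E c \<le> min_desc E x" using x C that by simp
    moreover have "min_desc E c \<noteq> min_desc E x"
      using min_desc_siblings[OF t fE] that x by auto
    ultimately show ?thesis by simp
  qed
  then have "heavy_child E x" using x(1) unfolding heavy_child_def by simp
  then show thesis by (rule that)
qed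

text \<open>One direction of the bijection: contraction yields an admissible pair, loses no
  information, and lowers the number of improper edges by one.\<close>

lemma contract_heavy:
  assumes t: "rooted_tree (insert n vs) r E" and h: "heavy_child E x"
  shows "(x, min_desc E x) \<in> expansion_data vs r (contract n x E)"
    and "expand n x (min_desc E x) (contract n x E) = E"
    and "card (improper_edges E) = Suc (card (improper_edges (contract n x E)))"
proof -
  let ?f = "id(n := x)" and ?E = "contract n x E" and ?F = "E - {(n, x)}"
  let ?g = "\<lambda>(i, j). if j = x then (i, n)
    else if i = x \<and> min_desc ?E j < min_desc E x then (n, j) else (i, j)"
  have nx: "(n, x) \<in> E" using h by (simp add: heavy_child_def)
  have t': "rooted_tree vs r ?E" by (rule rooted_tree_contract[OF t nx])
  have fE: "finite E" "finite ?E" using finite_tree finite_tree' t t' by auto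
  have xp: "a = n" if "(a, x) \<in> E" for a using tree_parent_unique[OF t that nx] .
  have "x \<noteq> n" using tree_acyclic[OF t] nx by blast
  then have xv: "x \<in> vs" using t nx by (auto simp: rooted_tree_def)
  have xr: "x \<noteq> r" using t nx by (auto simp: rooted_tree_def)
  have sub: "E \<subseteq> insert n vs \<times> insert n vs" using t by (simp add: rooted_tree_def)
  have loop: "(a, a) \<notin> E" for a using tree_acyclic[OF t] by blast
  have md: "min_desc ?E (?f b) = min_desc E b" if "(a, b) \<in> E" "b \<noteq> x" for a b
    using min_desc_contract[OF t nx] sub that by blast
  have md': "min_desc ?E b = min_desc E b" if "(a, b) \<in> E" "b \<noteq> x" "b \<noteq> n" for a b
    using md[OF that(1,2)] that(3) by simp
  have bx: "b \<noteq> x" if "(a, b) \<in> ?F" for a b using xp that by auto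
  \<comment> \<open>Edge by edge, \<open>?g\<close> undoes the renaming. A child of \<open>n\<close>
    has a minimum below that of \<open>x\<close> by the choice of \<open>x\<close>, so it is moved
    back; a child of \<open>x\<close> has a minimum at least that of \<open>x\<close>, so it
    stays.\<close>
  have inv: "?g (map_prod ?f ?f e) = e" if e: "e \<in> ?F" for e
  proof -
    obtain a b where ab: "e = (a, b)" by (cases e)
    have E: "(a, b) \<in> E" using e ab by simp
    have b: "b \<noteq> x" using bx e ab by simp
    show ?thesis
    proof (cases "b = n")
      case True
      then show ?thesis using ab E loop by auto
    next
      case False
      note m = md'[OF E b False]
      consider "a = n" | "a = x" | "a \<noteq> n" "a \<noteq> x" by blast
      then show ?thesis
      proof cases
        case 1
        then show ?thesis using h E b False m ab by (auto simp: heavy_child_def)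
      next
        case 2
        then show ?thesis using min_desc_child[OF fE(1), of x b] E b False m ab \<open>x \<noteq> n\<close> by auto
      qed (use ab b False in auto)
    qed
  qed
  have "g ` ?E = (\<lambda>e. g (map_prod ?f ?f e)) ` ?F" for g :: "'v \<times> 'v \<Rightarrow> 'v \<times> 'v"
    unfolding contract_def by (rule image_image)
  also have "(\<lambda>e. ?g (map_prod ?f ?f e)) ` ?F = ?F"
    by (subst image_cong[OF refl inv]) auto
  finally have "?g ` ?E = ?F" .
  then show "expand n x (min_desc E x) ?E = E"
    using nx unfolding expand_def by auto
  have inj: "inj_on (map_prod ?f ?f) ?F" by (rule inj_on_inverseI[where g = ?g], rule inv)
  have imp: "map_prod ?f ?f e \<in> improper_edges ?E \<longleftrightarrow> e \<in> improper_edges E" if e: "e \<in> ?F" for e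
  proof -
    obtain a b where ab: "e = (a, b)" by (cases e)
    have E: "(a, b) \<in> E" using e ab by simp
    have b: "b \<noteq> x" using bx e ab by simp
    have E': "(?f a, ?f b) \<in> ?E" using e ab unfolding contract_def by (metis image_eqI map_prod_simp)
    \<comment> \<open>Only edges leaving \<open>n\<close> change their tail. For them
      \<open>min_desc E b < min_desc E x \<le> x < n\<close>, so both comparisons hold.\<close>
    have "(min_desc E b < ?f a) = (min_desc E b < a)"
    proof (cases "a = n")
      case True
      then have "min_desc E b < min_desc E x" using h E b by (auto simp: heavy_child_def)
      also have "\<dots> \<le> x" by (rule min_desc_le[OF fE(1)]) simp
      finally show ?thesis using True n[OF xv] by auto
    qed simp
    then show ?thesis using E E' ab md[OF E b]
      by (auto simp: improper_edges_eq[OF fE(1)] improper_edges_eq[OF fE(2)] simp del: fun_upd_apply)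
  qed
  have "improper_edges ?E \<subseteq> map_prod ?f ?f ` ?F"
    unfolding improper_edges_def contract_def by auto
  then have "improper_edges ?E = map_prod ?f ?f ` {e \<in> ?F. map_prod ?f ?f e \<in> improper_edges ?E}"
    by (rule image_restrict)
  also have "{e \<in> ?F. map_prod ?f ?f e \<in> improper_edges ?E} = improper_edges E - {(n, x)}"
  proof (rule set_eqI)
    show "e \<in> {e \<in> ?F. map_prod ?f ?f e \<in> improper_edges ?E} \<longleftrightarrow> e \<in> improper_edges E - {(n, x)}" for e
      using imp[of e] improper_edges_subset[of E] by blast
  qed
  finally have "improper_edges ?E = map_prod ?f ?f ` (improper_edges E - {(n, x)})" .
  moreover have "inj_on (map_prod ?f ?f) (improper_edges E - {(n, x)})"
    by (rule inj_on_subset[OF inj]) (use improper_edges_subset in auto)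
  ultimately have card: "card (improper_edges ?E) = card (improper_edges E - {(n, x)})"
    by (simp only: card_image)
  have "min_desc E x < n" using min_desc_le[OF fE(1), of x x] n[OF xv] by simp
  then have "(n, x) \<in> improper_edges E" using nx by (simp add: improper_edges_eq[OF fE(1)])
  moreover have "finite (improper_edges E)"
    by (rule finite_subset[OF _ fE(1)]) (auto simp: improper_edges_def)
  ultimately show "card (improper_edges E) = Suc (card (improper_edges ?E))"
    unfolding card by (metis card.remove)
  show "(x, min_desc E x) \<in> expansion_data vs r ?E"
  proof (cases rule: min_desc_cases[OF fE(1), of x])
    case 1
    then show ?thesis using xv xr by (auto simp: expansion_data_def)
  next
    case (2 c)
    have cx: "c \<noteq> x" using 2 loop by auto
    have cn: "c \<noteq> n"
    proof
      assume "c = n"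
      with 2 nx have "(x, x) \<in> E\<^sup>+" by auto
      then show False using tree_acyclic[OF t] by blast
    qed
    show ?thesis
    \<comment> \<open>Only a minimum strictly below \<open>x\<close> makes the edge
      \<open>(x, c)\<close> improper; otherwise the diagonal pair applies.\<close>
    proof (cases "min_desc E x = x")
      case True
      then show ?thesis using xv xr by (auto simp: expansion_data_def)
    next
      case False
      then have "min_desc E x < x" using min_desc_le[OF fE(1), of x x] by simp
      then have "(x, c) \<in> improper_edges E" using 2 by (auto simp: improper_edges_eq[OF fE(1)])
      then have "(x, c) \<in> improper_edges ?E" using imp[of "(x, c)"] 2 \<open>x \<noteq> n\<close> cn by auto
      then show ?thesis using md'[OF 2(1) cx cn] 2(2) unfolding expansion_data_def
        by (intro UnI2 image_eqI[of _ _ "(x, c)"]) auto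
    qed
  qed
qed


section \<open>Admissible expansions of a tree\<close>

lemma expansion_data_iff:
  assumes t: "rooted_tree vs r E"
  shows "(x, t) \<in> expansion_data vs r E \<longleftrightarrow>
    x \<in> vs \<and> x \<noteq> r \<and> (t = x \<or> (\<exists>c. (x, c) \<in> E \<and> t = min_desc E c \<and> t < x))"
proof -
  have fE: "finite E" using t by (rule finite_tree)
  \<comment> \<open>Minimality of the root enters here: the tail of an improper edge exceeds some
    vertex of the tree.\<close>
  have "x \<in> vs \<and> x \<noteq> r" if "(x, c) \<in> E" "min_desc E c < x" for c
  proof -
    have xc: "x \<in> vs" "c \<in> vs" using that tree_subset[OF t] by auto
    then have "min_desc E c \<in> vs" using min_desc_in[OF fE, of c] descendants_subset[OF t] by blast
    then show ?thesis using r(2) xc that(2) by force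
  qed
  then show ?thesis
    unfolding expansion_data_def improper_edges_eq[OF fE] by (auto simp: image_iff)
qed

lemma finite_expansion_data:
  assumes "rooted_tree vs r E"
  shows "finite (expansion_data vs r E)"
proof -
  have "finite (improper_edges E)"
    by (rule finite_subset[OF improper_edges_subset finite_tree[OF assms]])
  then show ?thesis using fin by (simp add: expansion_data_def)
qed

text \<open>Improper edges give pairs with second entry below the first, so they miss the diagonal,
  and distinct siblings give distinct pairs.\<close>

lemma card_expansion_data:
  assumes t: "rooted_tree vs r E"
  shows "card (expansion_data vs r E) = card vs - 1 + card (improper_edges E)"
proof -
  have fE: "finite E" using t by (rule finite_tree)
  let ?h = "\<lambda>(x, c). (x, min_desc E c)"
  have inj: "inj_on ?h (improper_edges E)"
    using min_desc_siblings[OF t fE] by (auto simp: inj_on_def improper_edges_def)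
  have fin_imp: "finite (improper_edges E)" by (rule finite_subset[OF improper_edges_subset fE])
  have diag: "{(x, x) |x. x \<in> vs - {r}} = (\<lambda>x. (x, x)) ` (vs - {r})" by auto
  have "card (expansion_data vs r E) = card ((\<lambda>x. (x, x)) ` (vs - {r})) + card (?h ` improper_edges E)"
    unfolding expansion_data_def diag
    by (rule card_Un_disjoint) (use fin fin_imp in \<open>auto simp: improper_edges_eq[OF fE]\<close>)
  also have "card ((\<lambda>x. (x, x)) ` (vs - {r})) = card (vs - {r})"
    by (rule card_image) (simp add: inj_on_def)
  finally show ?thesis using r(1) by (simp add: card_image[OF inj])
qed

text \<open>The other direction of the bijection: an admissible pair \<open>(x, t)\<close> can be
  read off from the expanded tree, as its heavy child and the minimum below it.\<close>

lemma expand_properties: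
  assumes t: "rooted_tree vs r E" and d: "(x, t) \<in> expansion_data vs r E"
  shows "contract n x (expand n x t E) = E"
    and "rooted_tree (insert n vs) r (expand n x t E)"
    and "heavy_child (expand n x t E) x"
    and "min_desc (expand n x t E) x = t"
proof -
  let ?f = "id(n := x)" and ?E = "expand n x t E"
  let ?g = "\<lambda>(i, j). if j = x then (i, n)
    else if i = x \<and> min_desc E j < t then (n, j) else (i, j)"
  have fE: "finite E" using t by (rule finite_tree)
  have xv: "x \<in> vs" and xr: "x \<noteq> r" and tx: "t \<le> x"
    using d unfolding expansion_data_iff[OF t] by auto
  have xn: "x \<noteq> n" using xv n_notin by blast
  have sub: "i \<in> vs" "j \<in> vs" "i \<noteq> n" "j \<noteq> n" if "(i, j) \<in> E" for i j
    using that tree_subset[OF t] n_notin by auto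
  have nE: "(a, n) \<notin> E" "(n, a) \<notin> E" for a using sub by blast+
  have loop: "(a, a) \<notin> E" for a using tree_acyclic[OF t] by blast
  have im: "y \<in> g ` E \<longleftrightarrow> (\<exists>a b. (a, b) \<in> E \<and> y = g (a, b))" for y and g :: "'v \<times> 'v \<Rightarrow> 'v \<times> 'v"
    by (simp add: image_iff Bex_def)
  have E: "(i, j) \<in> ?E \<longleftrightarrow> (i, j) = (n, x) \<or> (\<exists>a b. (a, b) \<in> E \<and> (i, j) = ?g (a, b))" for i j
    unfolding expand_def insert_iff im ..
  \<comment> \<open>The edges are now sorted by their head: \<open>x\<close> hangs below
    \<open>n\<close>, \<open>n\<close> takes over the parent of \<open>x\<close>, and every other
    vertex keeps its parent unless it moves from \<open>x\<close> to \<open>n\<close>.\<close>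
  have in_x: "(i, x) \<in> ?E \<longleftrightarrow> i = n" for i
    unfolding E using xn by (auto split: if_splits)
  have in_n: "(i, n) \<in> ?E \<longleftrightarrow> (i, x) \<in> E" for i
  proof
    assume "(i, n) \<in> ?E"
    then obtain a b where "(a, b) \<in> E" "(i, n) = ?g (a, b)" using xn unfolding E by blast
    then show "(i, x) \<in> E" using nE by (auto split: if_splits)
  next
    assume "(i, x) \<in> E"
    then show "(i, n) \<in> ?E" unfolding E by (intro disjI2 exI[of _ i] exI[of _ x]) simp
  qed
  have in_other: "(i, j) \<in> ?E \<longleftrightarrow>
      (\<exists>a. (a, j) \<in> E \<and> i = (if a = x \<and> min_desc E j < t then n else a))"
    if j: "j \<noteq> x" "j \<noteq> n" for i j
  proof
    assume "(i, j) \<in> ?E"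
    then obtain a b where ab: "(a, b) \<in> E" "(i, j) = ?g (a, b)" using j unfolding E by blast
    then have "b = j" using j by (auto split: if_splits)
    then show "\<exists>a. (a, j) \<in> E \<and> i = (if a = x \<and> min_desc E j < t then n else a)"
      using ab j by (intro exI[of _ a]) (auto split: if_splits)
  next
    assume "\<exists>a. (a, j) \<in> E \<and> i = (if a = x \<and> min_desc E j < t then n else a)"
    then obtain a where "(a, j) \<in> E" "i = (if a = x \<and> min_desc E j < t then n else a)" by blast
    then show "(i, j) \<in> ?E" unfolding E using j
      by (intro disjI2 exI[of _ a] exI[of _ j]) simp
  qed
  have nx: "(n, x) \<in> ?E" by (simp add: in_x)
  have "(n, x) \<notin> ?g ` E" using xn by (auto split: if_splits)
  then have "?E - {(n, x)} = ?g ` E" unfolding expand_def by auto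
  then have "contract n x ?E = (\<lambda>e. map_prod ?f ?f (?g e)) ` E"
    unfolding contract_def by (simp only: image_image)
  also have "\<dots> = (\<lambda>e. e) ` E" by (rule image_cong[OF refl]) (use sub in auto)
  finally show contr: "contract n x ?E = E" by simp
  show t': "rooted_tree (insert n vs) r ?E"
    unfolding rooted_tree_def
  proof (intro conjI ballI allI)
    show "?E \<subseteq> insert n vs \<times> insert n vs"
      unfolding expand_def using xv sub by (auto split: if_splits)
    show "(i, r) \<notin> ?E" for i
    proof -
      have "(a, r) \<notin> E" for a using t by (simp add: rooted_tree_def)
      then show ?thesis using in_other[of r i] xr r(1) n_notin by auto
    qed
    show "\<exists>!i. (i, j) \<in> ?E" if j: "j \<in> insert n vs - {r}" for j
    proof -
      have par: "\<exists>!i. (i, j) \<in> E" if "j \<in> vs - {r}" for j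
        using t that by (simp add: rooted_tree_def)
      consider "j = x" | "j = n" | "j \<noteq> x" "j \<noteq> n" by blast
      then show ?thesis
      proof cases
        case 1
        then show ?thesis by (simp add: in_x)
      next
        case 2
        then show ?thesis using par[of x] xv xr by (simp add: in_n)
      next
        case 3
        then have "\<exists>!i. (i, j) \<in> E" using par j by simp
        then show ?thesis unfolding in_other[OF 3] by metis
      qed
    qed
    show "(r, j) \<in> ?E\<^sup>*" if j: "j \<in> insert n vs" for j
    proof -
      \<comment> \<open>Reachability from the root is pulled back through the contraction, already
        known to be \<open>E\<close>.\<close>
      have "?f j \<in> vs" using j xv by auto
      then have "(r, ?f j) \<in> E\<^sup>*" using t by (simp add: rooted_tree_def)
      moreover have "?f r = r" using r(1) n_notin by auto
      ultimately have "(?f r, ?f j) \<in> (contract n x ?E)\<^sup>*" using contr by simp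
      then show ?thesis
        using contract_rtrancl_iff[OF nx, of r j] in_x xr by blast
    qed
  qed (use r in simp)
  have fE': "finite ?E" using t' by (rule finite_tree')
  have md: "min_desc ?E b = min_desc E b" if "b \<in> vs" "b \<noteq> x" for b
  proof -
    have "?f b = b" using that n_notin by auto
    then show ?thesis using min_desc_contract[OF t' nx, of b] that contr by simp
  qed
  show "min_desc ?E x = t"
  proof (rule antisym)
    consider "t = x" | c where "(x, c) \<in> E" "t = min_desc E c"
      using d unfolding expansion_data_iff[OF t] by blast
    then show "min_desc ?E x \<le> t"
    proof cases
      case 1
      then show ?thesis using min_desc_le[OF fE', of x x] by simp
    next
      case 2
      have c: "c \<noteq> x" "c \<in> vs" "c \<noteq> n" using 2(1) loop sub by blast+
      \<comment> \<open>The child realizing \<open>t\<close> stays below \<open>x\<close> because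
        the comparison in \<open>expand\<close> is strict.\<close>
      have "(x, c) \<in> ?E" unfolding in_other[OF c(1,3)] using 2 by (intro exI[of _ x]) simp
      from min_desc_child[OF fE' this] show ?thesis unfolding md[OF c(2,1)] 2(2)[symmetric] .
    qed
    show "t \<le> min_desc ?E x"
    proof (cases rule: min_desc_cases[OF fE', of x])
      case (2 c)
      have c: "c \<noteq> x" "c \<noteq> n" using 2(1) in_x xn in_n loop by metis+
      then obtain a where a: "(a, c) \<in> E" "x = (if a = x \<and> min_desc E c < t then n else a)"
        using 2(1) in_other by blast
      then have "t \<le> min_desc E c" using xn by (auto split: if_splits)
      then show ?thesis using 2 md[OF sub(2)[OF a(1)] c(1)] by simp
    qed (use tx in simp)
  qed
  then have mdx: "min_desc ?E x = t" .
  show "heavy_child ?E x"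
    unfolding heavy_child_def
  proof (intro conjI allI impI nx)
    fix c assume c: "(n, c) \<in> ?E" "c \<noteq> x"
    then have cn: "c \<noteq> n" using in_n sub by blast
    then obtain a where a: "(a, c) \<in> E" "n = (if a = x \<and> min_desc E c < t then n else a)"
      using c in_other by blast
    have "a \<noteq> n" using a(1) nE by blast
    \<comment> \<open>The children of \<open>n\<close> other than \<open>x\<close> are those that
      were moved, hence their minima lie below \<open>t\<close>.\<close>
    then have "min_desc E c < t" using a(2) by (auto split: if_splits)
    then show "min_desc ?E c < min_desc ?E x" using md[OF sub(2)[OF a(1)] c(2)] mdx by simp
  qed
qed

section \<open>Trees in which the new vertex has children\<close>

lemma card_trees_internal:
  "card {E \<in> trees (insert n vs) r (Suc k). n \<in> Domain E} =
    (card vs - 1 + k) * card (trees vs r k)"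
proof -
  let ?A = "SIGMA E:trees vs r k. expansion_data vs r E"
  let ?B = "{E \<in> trees (insert n vs) r (Suc k). n \<in> Domain E}"
  let ?h = "\<lambda>(E, x, t). expand n x t E"
  have tr: "rooted_tree vs r E" if "E \<in> trees vs r k" for E using that by (simp add: trees_def)
  have inj: "inj_on ?h ?A"
  proof (rule inj_onI)
    fix a b assume ab: "a \<in> ?A" "b \<in> ?A" "?h a = ?h b"
    obtain E x t where a: "a = (E, x, t)" by (cases a)
    obtain E' x' t' where b: "b = (E', x', t')" by (cases b)
    have E: "E \<in> trees vs r k" "(x, t) \<in> expansion_data vs r E"
      and E': "E' \<in> trees vs r k" "(x', t') \<in> expansion_data vs r E'"
      and eq: "expand n x t E = expand n x' t' E'"
      using ab a b by simp_all
    note p = expand_properties[OF tr[OF E(1)] E(2)]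
    note p' = expand_properties[OF tr[OF E'(1)] E'(2), folded eq]
    \<comment> \<open>The heavy child determines \<open>x\<close>; contracting its edge then returns
      \<open>E\<close>, and its subtree minimum returns \<open>t\<close>.\<close>
    have "x = x'" using p(3) p'(3) by (rule heavy_child_unique)
    with p(1,4) p'(1,4) show "a = b" by (simp add: a b)
  qed
  have image: "?h ` ?A = ?B"
  proof (intro equalityI subsetI)
    fix F assume "F \<in> ?h ` ?A"
    then obtain E x t where E: "E \<in> trees vs r k" "(x, t) \<in> expansion_data vs r E"
      and F: "F = expand n x t E" by auto
    note p = expand_properties[OF tr[OF E(1)] E(2), folded F]
    have "card (improper_edges F) = Suc k"
      using contract_heavy(3)[OF p(2,3)] p(1) E(1) by (simp add: trees_def)
    moreover have "n \<in> Domain F" using p(3) by (auto simp: heavy_child_def)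
    ultimately show "F \<in> ?B" using p(2) by (simp add: trees_def)
  next
    fix F assume F: "F \<in> ?B"
    then have t: "rooted_tree (insert n vs) r F" by (simp add: trees_def)
    obtain x where x: "heavy_child F x" using heavy_child_exists[OF t] F by blast
    note p = contract_heavy[OF t x]
    have "rooted_tree vs r (contract n x F)"
      using rooted_tree_contract[OF t] x by (simp add: heavy_child_def)
    then have "contract n x F \<in> trees vs r k" using F p(3) by (simp add: trees_def)
    then show "F \<in> ?h ` ?A"
      using p(1,2) by (intro image_eqI[of _ _ "(contract n x F, x, min_desc F x)"]) auto
  qed
  have "card ?B = card ?A"
    unfolding image[symmetric] by (rule card_image[OF inj])
  also have "\<dots> = (\<Sum>E\<in>trees vs r k. card (expansion_data vs r E))"
    using finite_trees finite_expansion_data tr by (intro card_SigmaI) blast+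
  also have "\<dots> = (\<Sum>E\<in>trees vs r k. card vs - 1 + k)"
    by (rule sum.cong) (auto simp: trees_def card_expansion_data)
  finally show ?thesis by simp
qed

lemma internal_improper:
  assumes t: "rooted_tree (insert n vs) r E" and "n \<in> Domain E"
  shows "card (improper_edges E) \<noteq> 0"
proof -
  obtain x where "heavy_child E x" using assms heavy_child_exists[OF t] by blast
  then show ?thesis using contract_heavy(3)[OF t] by simp
qed

section \<open>Trees in which the new vertex is a leaf\<close>

lemma leaf_rtrancl:
  assumes "n \<notin> Domain E" "j \<noteq> n"
  shows "(i, j) \<in> (insert (p, n) E)\<^sup>* \<longleftrightarrow> (i, j) \<in> E\<^sup>*"
proof -
  have "(n, j) \<notin> E\<^sup>*" using assms by (metis DomainI converse_rtranclE)
  then show ?thesis unfolding rtrancl_insert by blast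
qed

text \<open>Stated as an equivalence because attaching the leaf and removing it both occur in the
  bijection that follows.\<close>

lemma rooted_tree_insert_leaf_iff:
  assumes sub: "E \<subseteq> vs \<times> vs" and p: "p \<in> vs"
  shows "rooted_tree (insert n vs) r (insert (p, n) E) \<longleftrightarrow> rooted_tree vs r E"
proof -
  have nE: "n \<notin> Domain E" "n \<notin> Range E" using sub n_notin by auto
  have nr: "n \<noteq> r" using r n_notin by blast
  have p': "(i, j) \<in> insert (p, n) E \<longleftrightarrow> (i, j) \<in> E" if "j \<noteq> n" for i j
    using that by auto
  have pn: "(i, n) \<in> insert (p, n) E \<longleftrightarrow> i = p" for i using nE by auto
  have "(\<forall>j\<in>vs - {r}. \<exists>!i. (i, j) \<in> insert (p, n) E) \<longleftrightarrow> (\<forall>j\<in>vs - {r}. \<exists>!i. (i, j) \<in> E)"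
    by (rule ball_cong[OF refl]) (use p' n_notin in auto)
  moreover have "insert n vs - {r} = insert n (vs - {r})" using nr by auto
  ultimately have a: "(\<forall>j\<in>insert n vs - {r}. \<exists>!i. (i, j) \<in> insert (p, n) E) \<longleftrightarrow>
      (\<forall>j\<in>vs - {r}. \<exists>!i. (i, j) \<in> E)"
    by (simp only: ball_simps pn) simp
  have l: "(r, j) \<in> (insert (p, n) E)\<^sup>* \<longleftrightarrow> (r, j) \<in> E\<^sup>*" if "j \<in> vs" for j
    using leaf_rtrancl[OF nE(1), of j] that n_notin by metis
  have "(r, n) \<in> (insert (p, n) E)\<^sup>*" if "(r, p) \<in> E\<^sup>*"
    using that unfolding rtrancl_insert by blast
  then have b: "(\<forall>j\<in>insert n vs. (r, j) \<in> (insert (p, n) E)\<^sup>*) \<longleftrightarrow> (\<forall>j\<in>vs. (r, j) \<in> E\<^sup>*)"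
    using p l by blast
  show ?thesis
    unfolding rooted_tree_def a b using sub p r nr by auto
qed

text \<open>The only possible new descendant \<open>n\<close> is too large to make an old edge
  improper, and the edge \<open>(p, n)\<close> is proper as \<open>n\<close> has no descendant but
  itself.\<close>

lemma improper_edges_insert_leaf:
  assumes sub: "E \<subseteq> vs \<times> vs" and p: "p \<in> vs"
  shows "improper_edges (insert (p, n) E) = improper_edges E"
proof -
  have nE: "n \<notin> Domain E" "n \<notin> Range E" using sub n_notin by auto
  have "descendants (insert (p, n) E) n = {n}"
    unfolding descendants_def rtrancl_insert using nE by (auto elim: converse_rtranclE)
  moreover have "(\<exists>d\<in>descendants (insert (p, n) E) j. d < i) \<longleftrightarrow> (\<exists>d\<in>descendants E j. d < i)"
    if "(i, j) \<in> E" for i j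
  proof -
    have "i < n" using that sub n by blast
    then show ?thesis using leaf_rtrancl[OF nE(1)] unfolding descendants_def
      by (metis less_asym mem_Collect_eq)
  qed
  ultimately have "(i, j) \<in> improper_edges (insert (p, n) E) \<longleftrightarrow> (i, j) \<in> improper_edges E" for i j
    using n[OF p] unfolding improper_edges_def by (cases "(i, j) \<in> E") auto
  then show ?thesis by (simp add: set_eq_iff split_paired_all)
qed

lemma card_trees_leaf:
  "card {E \<in> trees (insert n vs) r k. n \<notin> Domain E} = card vs * card (trees vs r k)"
proof -
  let ?B = "{E \<in> trees (insert n vs) r k. n \<notin> Domain E}"
  let ?h = "\<lambda>(E, p). insert (p, n) E"
  have tr: "E \<subseteq> vs \<times> vs" if "E \<in> trees vs r k" for E
    using that by (auto simp: trees_def dest: tree_subset)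
  have nr: "n \<noteq> r" using r n_notin by blast
  have inj: "inj_on ?h (trees vs r k \<times> vs)"
  proof (rule inj_onI)
    fix a b assume ab: "a \<in> trees vs r k \<times> vs" "b \<in> trees vs r k \<times> vs" "?h a = ?h b"
    obtain E p where a: "a = (E, p)" by (cases a)
    obtain E' p' where b: "b = (E', p')" by (cases b)
    have E: "E \<in> trees vs r k" "E' \<in> trees vs r k"
      and eq: "insert (p, n) E = insert (p', n) E'"
      using ab a b by simp_all
    have nE: "(q, n) \<notin> E" "(q, n) \<notin> E'" for q using E tr n_notin by blast+
    have "(p, n) \<in> insert (p', n) E'" using eq by blast
    then have "p = p'" using nE by simp
    moreover have "E = E'" using eq nE \<open>p = p'\<close> by (simp add: insert_ident)
    ultimately show "a = b" by (simp add: a b)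
  qed
  have image: "?h ` (trees vs r k \<times> vs) = ?B"
  proof (intro equalityI subsetI)
    fix F assume "F \<in> ?h ` (trees vs r k \<times> vs)"
    then obtain E p where E: "E \<in> trees vs r k" "p \<in> vs" "F = insert (p, n) E" by auto
    note s = tr[OF E(1)]
    have "n \<notin> Domain F" using s E n_notin by auto
    then show "F \<in> ?B"
      using E rooted_tree_insert_leaf_iff[OF s E(2)] improper_edges_insert_leaf[OF s E(2)]
      by (simp add: trees_def)
  next
    fix F assume F: "F \<in> ?B"
    then have t: "rooted_tree (insert n vs) r F" by (simp add: trees_def)
    have "\<forall>j\<in>insert n vs - {r}. \<exists>!i. (i, j) \<in> F" using t
      unfolding rooted_tree_def by (elim conjE)
    then obtain p where p: "(p, n) \<in> F" using nr by blast
    define E where "E = F - {(p, n)}"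
    have FE: "F = insert (p, n) E" using p by (auto simp: E_def)
    have i: "i \<in> vs" and j: "j \<in> insert n vs" if "(i, j) \<in> F" for i j
    proof -
      have "i \<noteq> n" using F that by blast
      then show "i \<in> vs" "j \<in> insert n vs" using tree_subset[OF t] that by auto
    qed
    have pv: "p \<in> vs" using i[OF p] .
    have s: "E \<subseteq> vs \<times> vs"
    proof (rule subrelI)
      fix a b assume "(a, b) \<in> E"
      then have ab: "(a, b) \<in> F" "(a, b) \<noteq> (p, n)" by (simp_all add: E_def)
      then have "b \<noteq> n" using tree_parent_unique[OF t _ p] by blast
      then show "(a, b) \<in> vs \<times> vs" using i[OF ab(1)] j[OF ab(1)] by simp
    qed
    have "E \<in> trees vs r k"
      using F rooted_tree_insert_leaf_iff[OF s pv] improper_edges_insert_leaf[OF s pv]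
      unfolding trees_def FE by simp
    then show "F \<in> ?h ` (trees vs r k \<times> vs)" using FE pv by auto
  qed
  have "card ?B = card (trees vs r k \<times> vs)"
    unfolding image[symmetric] by (rule card_image[OF inj])
  then show ?thesis by (simp add: card_cartesian_product)
qed

lemma card_trees_0: "card (trees (insert n vs) r 0) = card vs * card (trees vs r 0)"
proof -
  have "{E \<in> trees (insert n vs) r 0. n \<notin> Domain E} = trees (insert n vs) r 0"
    using internal_improper unfolding trees_def by blast
  then show ?thesis using card_trees_leaf[of 0] by simp
qed

lemma card_trees_Suc:
  "card (trees (insert n vs) r (Suc k)) =
    card vs * card (trees vs r (Suc k)) + (card vs - 1 + k) * card (trees vs r k)"
proof -
  let ?F = "trees (insert n vs) r (Suc k)"
  have "card ?F = card {E \<in> ?F. n \<notin> Domain E} + card {E \<in> ?F. n \<in> Domain E}"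
    by (subst card_Un_disjoint[symmetric]) (use finite_trees'[of "Suc k"] in \<open>auto intro!: arg_cong[of _ _ card]\<close>)
  then show ?thesis unfolding card_trees_leaf card_trees_internal .
qed

end

section \<open>Recurrence for \<open>T\<close> and its generating polynomials\<close>

lemma T_eq_card_trees: "T m k = card (trees {1..m+1} 1 k)"
  unfolding T_def trees_def ..

text \<open>Here \<open>card vs = m + 1\<close>, which gives the factors \<open>m + 1\<close> and
  \<open>m + k\<close> of the recurrence.\<close>

lemma new_maximum_atLeastAtMost: "new_maximum {1..m+1} 1 (Suc m + 1)"
  by unfold_locales auto

lemma T_0: "T 0 k = (if k = 0 then 1 else 0)"
proof -
  have tree: "rooted_tree {1..0+1} 1 E \<longleftrightarrow> E = {}" for E :: "(nat \<times> nat) set"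
    by (auto simp: rooted_tree_def)
  have "T 0 k = card {E :: (nat \<times> nat) set. E = {} \<and> card (improper_edges E) = k}"
    unfolding T_def tree ..
  also have "{E :: (nat \<times> nat) set. E = {} \<and> card (improper_edges E) = k} =
      (if k = 0 then {{}} else {})"
    by (auto simp: improper_edges_def)
  finally show ?thesis by simp
qed

lemma T_Suc_0: "T (Suc m) 0 = (m + 1) * T m 0"
proof -
  have *: "{1..Suc m + 1} = insert (Suc m + 1) {1..m + 1}" by auto
  show ?thesis
    unfolding T_eq_card_trees * using new_maximum.card_trees_0[OF new_maximum_atLeastAtMost, of m] by simp
qed

lemma T_Suc_Suc: "T (Suc m) (Suc k) = (m + 1) * T m (Suc k) + (m + k) * T m k"
proof -
  have *: "{1..Suc m + 1} = insert (Suc m + 1) {1..m + 1}" by auto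
  show ?thesis
    unfolding T_eq_card_trees *
    using new_maximum.card_trees_Suc[OF new_maximum_atLeastAtMost, of m k] by simp
qed

lemma T_eq_0: "m \<le> k \<Longrightarrow> 0 < k \<Longrightarrow> T m k = 0"
proof (induction m arbitrary: k)
  case (Suc m)
  then obtain l where k: "k = Suc l" "m \<le> l" by (cases k) auto
  then have "T m (Suc l) = 0" using Suc.IH by simp
  \<comment> \<open>For \<open>l = 0\<close> the bound forces \<open>m = 0\<close>, so the factor
    vanishes although \<open>T 0 0 = 1\<close>.\<close>
  moreover have "(m + l) * T m l = 0" using Suc.IH[of l] k by (cases "l = 0") auto
  ultimately show ?case by (simp add: k T_Suc_Suc)
qed (simp add: T_0)

text \<open>Extending the sum to \<open>k = m\<close> adds a zero term if \<open>m > 0\<close> and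
  brings the separately defined case \<open>m = 0\<close> under the same formula.\<close>

lemma T_poly_eq: "T_poly m x = (\<Sum>k\<le>m. of_nat (T m k) * x ^ k)"
proof (cases m)
  case 0
  then show ?thesis by (simp add: T_poly_def T_0)
next
  case (Suc l)
  then have "T m m = 0" by (intro T_eq_0) auto
  then show ?thesis using Suc by (simp add: T_poly_def atLeast0AtMost)
qed

lemma T_poly_Suc:
  fixes x :: "'a::comm_ring_1"
  shows "T_poly (Suc m) x =
    (\<Sum>k\<le>m. of_nat (T m k) * (of_nat (m + 1) * x ^ k + of_nat (m + k) * x ^ Suc k))"
proof -
  have "T m (Suc m) = 0" by (intro T_eq_0) auto
  \<comment> \<open>The vanishing top term is added so that, once the term for \<open>k = 0\<close>
    is split off, both sums run over the powers \<open>x ^ Suc k\<close> with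
    \<open>k \<le> m\<close>.\<close>
  then have "(\<Sum>k\<le>m. of_nat (T m k) * (of_nat (m + 1) * x ^ k)) =
      (\<Sum>k\<le>Suc m. of_nat ((m + 1) * T m k) * x ^ k)"
    by (simp add: algebra_simps)
  also have "\<dots> = of_nat ((m + 1) * T m 0) + (\<Sum>k\<le>m. of_nat ((m + 1) * T m (Suc k)) * x ^ Suc k)"
    by (subst sum.atMost_Suc_shift) simp
  finally have shift: "(\<Sum>k\<le>m. of_nat (T m k) * (of_nat (m + 1) * x ^ k)) = \<dots>" .
  have "(\<Sum>k\<le>m. of_nat (T m k) * (of_nat (m + 1) * x ^ k + of_nat (m + k) * x ^ Suc k)) =
      (\<Sum>k\<le>m. of_nat (T m k) * (of_nat (m + 1) * x ^ k)) +
      (\<Sum>k\<le>m. of_nat ((m + k) * T m k) * x ^ Suc k)"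
    unfolding distrib_left[of "of_nat (T m _)"] sum.distrib by (simp only: of_nat_mult mult_ac)
  also have "\<dots> = of_nat ((m + 1) * T m 0) +
      (\<Sum>k\<le>m. of_nat ((m + 1) * T m (Suc k) + (m + k) * T m k) * x ^ Suc k)"
    unfolding shift by (simp only: of_nat_add[of "(m + 1) * _"] distrib_right[of "of_nat _"] sum.distrib add.assoc)
  also have "\<dots> = (\<Sum>k\<le>Suc m. of_nat (T (Suc m) k) * x ^ k)"
    unfolding sum.atMost_Suc_shift T_Suc_Suc[symmetric] by (simp add: T_Suc_0)
  finally show ?thesis by (simp add: T_poly_eq)
qed

section \<open>Derivations and the grammar\<close>

lemma derivation_0: "derivation D \<Longrightarrow> D 0 = 0"
  unfolding derivation_def by (metis add_cancel_right_right)

lemma derivation_sum: "derivation D \<Longrightarrow> D (\<Sum>i\<in>A. f i) = (\<Sum>i\<in>A. D (f i))"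
  by (induction A rule: infinite_finite_induct) (auto simp: derivation_0, auto simp: derivation_def)

lemma derivation_of_nat:
  assumes "derivation D" shows "D (of_nat c * f) = of_nat c * D f"
  using assms by (induction c) (auto simp: derivation_0 distrib_right, auto simp: derivation_def)

text \<open>With \<open>g\<close> as logarithmic derivative of \<open>f\<close>, the power rule
  needs no exponent \<open>k - 1\<close>.\<close>

lemma derivation_power:
  assumes D: "derivation D" and f: "D f = f * g"
  shows "D (f ^ k) = of_nat k * f ^ k * g"
proof (induction k)
  case 0
  have "D (1 * 1) = D 1 * 1 + 1 * D 1" using D unfolding derivation_def by blast
  then show ?case by simp
next
  case (Suc k)
  have "D (f * f ^ k) = D f * f ^ k + f * D (f ^ k)" using D unfolding derivation_def by blast
  then show ?case using f Suc by (simp add: algebra_simps)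
qed

theorem theorem2p2:
  fixes D :: "'a::comm_ring_1 laurent3 \<Rightarrow> 'a laurent3" and n :: nat
  assumes "derivation D"
    and "D Z = V * Z^2"
    and "D V = U * V^2 * Z"
    and "D U = U^2 * V * Z"
    and "n \<ge> 1"
  shows "(D ^^ (n - 1)) Z = V ^ (n - 1) * Z ^ n * T_poly (n - 1) U"
proof -
  note D = assms(1)
  have leib: "D (f * g) = D f * g + f * D g" for f g using D unfolding derivation_def by blast
  \<comment> \<open>The logarithmic derivatives: \<open>V * Z\<close> for \<open>Z\<close>, and
    \<open>U * V * Z\<close> for both \<open>V\<close> and \<open>U\<close>.\<close>
  have "D Z = Z * (V * Z)" "D V = V * (U * V * Z)" "D U = U * (U * V * Z)"
    using assms by (simp_all add: power2_eq_square mult_ac)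
  note pow = this[THEN derivation_power[OF D]]
  \<comment> \<open>The \<open>Suc m\<close> factors \<open>Z\<close> contribute
    \<open>m + 1\<close>; the \<open>m\<close> factors \<open>V\<close> and \<open>k\<close> factors
    \<open>U\<close> together contribute \<open>m + k\<close> and one more \<open>U\<close>.\<close>
  have mono: "D (V ^ m * Z ^ Suc m * U ^ k) = V ^ Suc m * Z ^ Suc (Suc m) *
      (of_nat (m + 1) * U ^ k + of_nat (m + k) * U ^ Suc k)" for m k
    unfolding leib pow by (simp add: algebra_simps)
  have main: "(D ^^ m) Z = V ^ m * Z ^ Suc m * T_poly m U" for m
  proof (induction m)
    case 0
    then show ?case by (simp add: T_poly_def)
  next
    case (Suc m)
    have "(D ^^ Suc m) Z = D (\<Sum>k\<le>m. of_nat (T m k) * (V ^ m * Z ^ Suc m * U ^ k))"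
      by (simp only: funpow.simps o_apply Suc T_poly_eq sum_distrib_left mult_ac)
    also have "\<dots> = (\<Sum>k\<le>m. of_nat (T m k) * (V ^ Suc m * Z ^ Suc (Suc m) *
        (of_nat (m + 1) * U ^ k + of_nat (m + k) * U ^ Suc k)))"
      by (simp only: derivation_sum[OF D] derivation_of_nat[OF D] mono)
    also have "\<dots> = V ^ Suc m * Z ^ Suc (Suc m) * T_poly (Suc m) U"
      unfolding T_poly_Suc sum_distrib_left by (simp only: mult_ac)
    finally show ?case .
  qed
  show ?thesis using main[of "n - 1"] assms(5) by simp
qed

end
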